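(* Let $C\subset\mathbb E^d$ be compact, convex, and with $B^d\subset C$. Then the following claims are equivalent: (i) $B^d$ is the unique ellipsoid of maximum volume in $C$. (ii) There are $u_k\in B^d\cap \operatorname{bd} C$ and real numbers $\lambda_k>0$, $k=1,\dots,n$, where $d+1\le n\le \frac12 d(d+3)$, such that $$I=\sum_{k=1}^n \lambda_k\, u_k\otimes u_k,\qquad o=\sum_{k=1}^n \lambda_k\, u_k.$$
   Context: $\mathbb E^d$ is Euclidean $d$-space, with origin $o$. $B^d$ is the solid (closed) unit ball of $\mathbb E^d$ centered at $o$. $I$ is the $d\times d$ unit (identity) matrix. For $u,v\in\mathbb E^d$ (column vectors), $u\otimes v$ denotes the $d\times d$ matrix $u\,v^T$. $\operatorname{bd} C$ is the boundary of $C$. An ellipsoid in $\mathbb E^d$ is a (solid, non-degenerate) set of the form $AB^d+a$ with $A$ a symmetric positive definite $d\times d$ matrix and $a\in\mathbb E^d$. *)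

theory Defs
  imports "HOL-Analysis.Analysis"
begin

definition sym_pos_def :: "real^'n^'n \<Rightarrow> bool" where
  "sym_pos_def A \<longleftrightarrow> transpose A = A \<and> (\<forall>x. x \<noteq> 0 \<longrightarrow> x \<bullet> (A *v x) > 0)"

definition ellipsoid :: "(real^'n) set \<Rightarrow> bool" where
  "ellipsoid E \<longleftrightarrow> (\<exists>A a. sym_pos_def A \<and> E = (\<lambda>x. A *v x + a) ` cball 0 1)"

definition tensor :: "real^'n \<Rightarrow> real^'n \<Rightarrow> real^'n^'n" where
  "tensor u v = (\<chi> i j. u $ i * v $ j)"

definition max_volume_ellipsoid :: "(real^'n) set \<Rightarrow> (real^'n) set \<Rightarrow> bool" where
  "max_volume_ellipsoid C E \<longleftrightarrow> ellipsoid E \<and> E \<subseteq> C \<and>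
     (\<forall>F. ellipsoid F \<and> F \<subseteq> C \<longrightarrow> measure lebesgue F \<le> measure lebesgue E)"

end

theory Submission
  imports Defs
begin

text \<open>
  If the contact points carry weights as in (ii), then \<open>C\<close> lies in the half-spaces \<open>u\<^sub>k \<bullet> x \<le> 1\<close>. For
  an ellipsoid \<open>A B + a \<subseteq> C\<close> this gives \<open>u\<^sub>k \<bullet> (A u\<^sub>k + a) \<le> 1\<close>, and summing with the weights yields
  \<open>trace A \<le> d\<close>; the arithmetic-geometric mean inequality for the eigenvalues shows \<open>det A \<le> 1\<close> with
  equality only for \<open>A = I\<close>, which forces \<open>a = 0\<close>. Conversely, if \<open>(I/d, 0)\<close> is not in the convex hull
  of the points \<open>(u \<otimes> u, u)\<close>, a separating hyperplane provides a symmetric \<open>H\<close> of positive trace and a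
  vector \<open>h\<close> with \<open>u \<bullet> (H u + h) < 0\<close> at all contact points; then \<open>(I - t H)\<^sup>-\<^sup>1 B + t h\<close> lies in \<open>C\<close>
  for small \<open>t > 0\<close> and has larger volume than \<open>B\<close>, since \<open>trace (I - t H) < d\<close>. The bound on the
  number of points is Caratheodory's theorem in the affine space of pairs of a symmetric matrix of
  trace 1 and a vector.
\<close>

section \<open>Spectral theorem\<close>

text \<open>The quadratic form attains its maximum on the compact unit sphere of \<open>S\<close>,
  and first-order optimality makes the maximizer an eigenvector. Working inside an invariant
  subspace prepares the induction for the eigenbasis.\<close>

lemma selfadjoint_eigenvector:
  fixes f :: "'a::euclidean_space \<Rightarrow> 'a"
  assumes "linear f" and self: "\<And>x y. f x \<bullet> y = x \<bullet> f y"
    and S: "subspace S" "S \<noteq> {0}" "f ` S \<subseteq> S"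
  obtains v c where "v \<in> S" "norm v = 1" "f v = c *\<^sub>R v"
proof -
  interpret f: linear f by fact
  define K where "K = S \<inter> sphere 0 1"
  obtain w where w: "w \<in> S" "w \<noteq> 0"
    using S subspace_0 by blast
  have "(1 / norm w) *\<^sub>R w \<in> K"
    using w by (simp add: K_def S subspace_scale)
  moreover have "compact K"
    unfolding K_def by (intro closed_Int_compact closed_subspace S compact_sphere)
  moreover have "continuous_on K (\<lambda>x. x \<bullet> f x)"
    by (intro continuous_intros linear_continuous_on linear_conv_bounded_linear[THEN iffD1] assms)
  ultimately obtain v where v: "v \<in> K" and max: "\<And>x. x \<in> K \<Longrightarrow> x \<bullet> f x \<le> v \<bullet> f v"
    by (metis continuous_attains_sup empty_iff)
  define c where "c = v \<bullet> f v"
  have vS: "v \<in> S" and nv: "norm v = 1" and vv: "v \<bullet> v = 1"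
    using v by (auto simp: K_def dot_square_norm)
  have le: "x \<bullet> f x \<le> c * (x \<bullet> x)" if "x \<in> S" for x
  proof (cases "x = 0")
    case False
    have "(x /\<^sub>R norm x) \<bullet> f (x /\<^sub>R norm x) \<le> c"
      unfolding c_def using that False by (intro max) (simp add: K_def S subspace_scale)
    then have "(x \<bullet> f x) / (norm x)\<^sup>2 \<le> c"
      by (simp add: f.scale power2_eq_square field_simps)
    then show ?thesis
      using False by (simp add: field_simps dot_square_norm)
  qed (simp add: f.zero)
  define w where "w = f v - c *\<^sub>R v"
  have wS: "w \<in> S"
    unfolding w_def using S vS by (intro subspace_diff subspace_scale) auto
  have vw: "v \<bullet> w = 0"
    by (simp add: w_def inner_diff_right vv c_def)
  have ww: "w \<bullet> f v = w \<bullet> w"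
  proof -
    have "f v = w + c *\<^sub>R v" by (simp add: w_def)
    then show ?thesis using vw by (simp add: inner_add_right inner_commute)
  qed
  \<comment> \<open>first-order optimality of \<open>v\<close> in the direction \<open>w\<close>\<close>
  have quad: "2 * t * (w \<bullet> w) \<le> t\<^sup>2 * (c * (w \<bullet> w) - w \<bullet> f w)" for t
  proof -
    have "(v + t *\<^sub>R w) \<bullet> f (v + t *\<^sub>R w) \<le> c * ((v + t *\<^sub>R w) \<bullet> (v + t *\<^sub>R w))"
      using wS vS S by (intro le subspace_add subspace_scale)
    moreover have "v \<bullet> f w = w \<bullet> w"
      using self[of v w] ww by (simp add: inner_commute)
    ultimately show ?thesis
      using vw ww vv
      by (simp add: f.add f.scale inner_add_left inner_add_right inner_commute[of w v] c_def[symmetric]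
          power2_eq_square algebra_simps)
  qed
  have "w \<bullet> w = 0"
  proof (rule ccontr)
    assume "w \<bullet> w \<noteq> 0"
    then have nz: "w \<bullet> w > 0" by simp
    \<comment> \<open>With \<open>t = (w \<bullet> w) / q\<close> the right side of
      \<open>quad\<close> is at most half of the left side; the \<open>+ 1\<close> keeps
      \<open>q\<close> positive.\<close>
    define q where "q = \<bar>c * (w \<bullet> w) - w \<bullet> f w\<bar> + 1"
    define t where "t = (w \<bullet> w) / q"
    have q: "q > 0" "c * (w \<bullet> w) - w \<bullet> f w \<le> q" by (auto simp: q_def)
    have t: "t > 0" unfolding t_def using nz q(1) by (rule divide_pos_pos)
    have "2 * t * (w \<bullet> w) \<le> t\<^sup>2 * q"
      using quad[of t] q(2) by (meson mult_left_mono order_trans zero_le_power2)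
    also have "\<dots> = t * (w \<bullet> w)"
      using q by (simp add: t_def power2_eq_square)
    finally show False
      using mult_pos_pos[OF t nz] by linarith
  qed
  then have "f v = c *\<^sub>R v" by (simp add: w_def)
  then show thesis using that vS nv by blast
qed

text \<open>Induction on the dimension: after one eigenvector \<open>v\<close> is split off,
  self-adjointness keeps the orthogonal complement of \<open>v\<close> in \<open>S\<close>
  invariant.\<close>

lemma selfadjoint_orthonormal_eigenbasis:
  fixes f :: "'a::euclidean_space \<Rightarrow> 'a"
  assumes "linear f" and self: "\<And>x y. f x \<bullet> y = x \<bullet> f y"
    and "subspace S" "f ` S \<subseteq> S"
  shows "\<exists>B\<subseteq>S. pairwise orthogonal B \<and> (\<forall>b\<in>B. norm b = 1 \<and> (\<exists>c. f b = c *\<^sub>R b)) \<and> span B = S"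
  using assms(3,4)
proof (induction "dim S" arbitrary: S rule: less_induct)
  case (less S)
  interpret f: linear f by fact
  show ?case
  proof (cases "S = {0}")
    case True
    then show ?thesis by (intro exI[of _ "{}"]) auto
  next
    case False
    then obtain v c where v: "v \<in> S" "norm v = 1" "f v = c *\<^sub>R v"
      using selfadjoint_eigenvector[OF assms(1) self less.prems(1) _ less.prems(2)] by metis
    have vv: "v \<bullet> v = 1" using v by (simp add: dot_square_norm)
    define T where "T = S \<inter> {x. v \<bullet> x = 0}"
    have T: "subspace T"
      unfolding T_def by (intro subspace_inter less.prems subspace_hyperplane)
    have "v \<bullet> f x = 0" if "v \<bullet> x = 0" for x
      using self[of v x] that v by simp
    then have fT: "f ` T \<subseteq> T"
      using less.prems by (auto simp: T_def)
    have "v \<notin> T" by (simp add: T_def vv)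
    moreover have "T \<subseteq> S" by (simp add: T_def)
    ultimately have "T \<subset> S" using v by blast
    then have "dim T < dim S"
      using T less.prems by (metis dim_psubset span_eq_iff)
    then obtain B where B: "B \<subseteq> T" "pairwise orthogonal B" "span B = T"
        "\<forall>b\<in>B. norm b = 1 \<and> (\<exists>c. f b = c *\<^sub>R b)"
      using less.hyps[OF _ T fT] by blast
    have "span (insert v B) = S"
    proof
      show "span (insert v B) \<subseteq> S"
        using v B less.prems by (intro span_minimal) (auto simp: T_def)
      show "S \<subseteq> span (insert v B)"
      proof
        fix x assume x: "x \<in> S"
        have "x - (v \<bullet> x) *\<^sub>R v \<in> T"
          using x v less.prems by (simp add: T_def subspace_diff subspace_scale inner_diff_right vv)
        then show "x \<in> span (insert v B)"
          unfolding span_insert using B by blast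
      qed
    qed
    moreover have "pairwise orthogonal (insert v B)"
      using B by (auto simp: pairwise_insert orthogonal_def T_def inner_commute)
    ultimately show ?thesis
      using B v by (intro exI[of _ "insert v B"]) (auto simp: T_def)
  qed
qed

lemma symmetric_matrix_inner:
  fixes A :: "real^'n^'n"
  assumes "transpose A = A"
  shows "(A *v x) \<bullet> y = x \<bullet> (A *v y)"
  by (metis assms dot_lmul_matrix transpose_matrix_vector)

text \<open>The columns of \<open>P\<close> are an orthonormal eigenbasis. The columnwise form
  serves for the signs of the eigenvalues, the matrix form for trace and determinant.\<close>

lemma symmetric_matrix_diagonalization:
  fixes A :: "real^'n^'n"
  assumes A: "transpose A = A"
  obtains P :: "real^'n^'n" and c :: "'n \<Rightarrow> real"
  where "orthogonal_matrix P" "\<And>i. A *v column i P = c i *\<^sub>R column i P"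
    "A ** P = P ** (\<chi> i j. if i = j then c i else 0)"
proof -
  obtain B where B: "pairwise orthogonal B" "span B = UNIV"
      "\<forall>b\<in>B. norm b = 1 \<and> (\<exists>c. A *v b = c *\<^sub>R b)"
    using selfadjoint_orthonormal_eigenbasis[of "(*v) A" UNIV] symmetric_matrix_inner[OF A]
    by auto
  have "independent B"
    using B by (intro pairwise_orthogonal_independent) auto
  then have fin: "finite B" and "card B = CARD('n)"
    using B independent_imp_finite dim_eq_card[of B UNIV] by auto
  then obtain b where b: "bij_betw b (UNIV :: 'n set) B"
    using finite_same_card_bij[of "UNIV :: 'n set" B] by auto
  define P :: "real^'n^'n" where "P = (\<chi> i j. b j $ i)"
  have col: "column j P = b j" for j
    by (simp add: column_def P_def vec_eq_iff)
  have bB: "b j \<in> B" for j using b by (auto simp: bij_betw_def)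
  have P: "orthogonal_matrix P"
    unfolding orthogonal_matrix_orthonormal_columns col
    using b bB B by (metis UNIV_I bij_betw_imp_inj_on inj_onD pairwiseD)
  define c where "c j = (SOME c. A *v b j = c *\<^sub>R b j)" for j
  have eig: "A *v b j = c j *\<^sub>R b j" for j
    unfolding c_def using B bB by (metis (mono_tags, lifting) someI_ex)
  have "A ** P = P ** (\<chi> i j. if i = j then c i else 0)"
  proof -
    have "(A ** P) $ i $ j = (P ** (\<chi> i j. if i = j then c i else 0)) $ i $ j" for i j
    proof -
      have "(A ** P) $ i $ j = (A *v b j) $ i"
        by (simp add: matrix_matrix_mult_def matrix_vector_mult_def P_def)
      then show ?thesis
        by (simp add: eig matrix_matrix_mult_def P_def if_distrib cong: if_cong)
    qed
    then show ?thesis by (simp add: vec_eq_iff)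
  qed
  with P eig that[of P c] show thesis by (simp add: col)
qed

section \<open>The inequality between determinant and trace\<close>

text \<open>The equality case of the arithmetic-geometric mean inequality, through
  \<open>ln x \<le> x - 1\<close>: the defects \<open>c i - 1 - ln (c i)\<close> are nonnegative
  with sum at most 0, so each vanishes, which happens only at 1.\<close>

lemma sum_eq_prod_eq_1:
  fixes c :: "'a \<Rightarrow> real"
  assumes "finite I" "\<And>i. i \<in> I \<Longrightarrow> c i > 0" "sum c I \<le> card I" "prod c I \<ge> 1" "i \<in> I"
  shows "c i = 1"
proof -
  have "0 \<le> ln (prod c I)" using assms(4) by (rule ln_ge_zero)
  also have "\<dots> = (\<Sum>i\<in>I. ln (c i))" using assms(1,2) by (intro ln_prod) (auto simp: less_imp_neq[symmetric])
  finally have "(\<Sum>i\<in>I. c i - 1 - ln (c i)) \<le> 0"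
    using assms by (simp add: sum_subtractf)
  moreover have nn: "c i - 1 - ln (c i) \<ge> 0" if "i \<in> I" for i
    using ln_le_minus_one[of "c i"] assms that by simp
  ultimately have "(\<Sum>i\<in>I. c i - 1 - ln (c i)) = 0"
    by (simp add: antisym sum_nonneg)
  then have "c i - 1 - ln (c i) = 0"
    using sum_nonneg_eq_0_iff[OF assms(1), of "\<lambda>i. c i - 1 - ln (c i)"] nn assms(5) by blast
  then show ?thesis using ln_eq_minus_one[of "c i"] assms by simp
qed

text \<open>The eigenvalues are positive with sum at most \<open>CARD('n)\<close> and product at
  least 1, hence all equal to 1. This serves both directions: uniqueness of the ball, and the volume
  gain under perturbation.\<close>

lemma sym_pos_def_trace_det_eq_mat_1:
  fixes A :: "real^'n^'n"
  assumes A: "sym_pos_def A" and tr: "trace A \<le> CARD('n)" and det: "\<bar>det A\<bar> \<ge> 1"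
  shows "A = mat 1"
proof -
  have "transpose A = A" using A by (simp add: sym_pos_def_def)
  then obtain P c where P: "orthogonal_matrix P" and eig: "\<And>i. A *v column i P = c i *\<^sub>R column i P"
    and AP: "A ** P = P ** (\<chi> i j. if i = j then c i else 0)"
    by (rule symmetric_matrix_diagonalization) blast
  let ?D = "(\<chi> i j. if i = j then c i else 0) :: real^'n^'n"
  have PP: "P ** transpose P = mat 1" "transpose P ** P = mat 1"
    using P by (auto simp: orthogonal_matrix_def)
  have A_eq: "A = P ** ?D ** transpose P"
    by (metis AP PP(1) matrix_mul_assoc matrix_mul_rid)
  have pos: "c i > 0" for i
  proof -
    have n: "norm (column i P) = 1"
      using P by (simp add: orthogonal_matrix_orthonormal_columns)
    then have "0 < column i P \<bullet> (A *v column i P)"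
      using A unfolding sym_pos_def_def by (metis norm_zero zero_neq_one)
    then show ?thesis by (simp add: eig dot_square_norm n)
  qed
  have "trace A = trace (transpose P ** (P ** ?D))"
    unfolding A_eq by (rule trace_mul_sym)
  also have "\<dots> = trace ?D" by (simp add: matrix_mul_assoc PP)
  finally have "sum c UNIV \<le> CARD('n)" using tr by (simp add: trace_def)
  moreover have "det A = det ?D"
  proof -
    have "det P * det (transpose P) = 1" by (metis PP(1) det_I det_mul)
    then show ?thesis by (simp add: A_eq det_mul)
  qed
  then have "prod c UNIV \<ge> 1"
    using det pos by (simp add: det_diagonal prod_pos abs_of_pos)
  ultimately have "c i = 1" for i
    using pos by (intro sum_eq_prod_eq_1[of UNIV]) auto
  then have "?D = mat 1" by (simp add: mat_def vec_eq_iff)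
  then show ?thesis using A_eq PP by simp
qed

section \<open>Volumes of linear images\<close>

lemma det_shear:
  fixes m n :: "'n::finite"
  assumes "m \<noteq> n"
  shows "det (matrix (\<lambda>x::real^'n. \<chi> i. if i = m then x $ m + x $ n else x $ i)) = 1"
proof -
  have "matrix (\<lambda>x::real^'n. \<chi> i. if i = m then x $ m + x $ n else x $ i)
      = (\<chi> k. if k = m then row m (mat 1) + 1 *s row n (mat 1) else row k (mat 1))"
    by (auto simp: matrix_def vec_eq_iff row_def axis_def mat_def)
  then show ?thesis using det_row_operation[OF assms, of "mat 1" 1] by simp
qed

text \<open>The library states this only for index types of class \<open>wellorder\<close>.\<close>

lemma
  fixes f :: "real^'n \<Rightarrow> real^'n"
  assumes "linear f" "S \<in> lmeasurable"
  shows lmeasurable_linear_image_cart: "f ` S \<in> lmeasurable"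
    and measure_linear_image_cart: "measure lebesgue (f ` S) = \<bar>det (matrix f)\<bar> * measure lebesgue S"
proof -
  \<comment> \<open>Measurability is bundled with the volume formula so that the property passes to
    compositions in the induction over elementary linear maps.\<close>
  define P where "P f \<longleftrightarrow> (\<forall>S\<in>lmeasurable. f ` S \<in> lmeasurable \<and>
    measure lebesgue (f ` S) = \<bar>det (matrix f)\<bar> * measure lebesgue S)" for f :: "real^'n \<Rightarrow> real^'n"
  \<comment> \<open>For maps of determinant 1 or -1 it is enough to compare volumes of boxes, and a
    translation moves the lower corner to 0. This covers transpositions and shears.\<close>
  have box: "P f" if f: "linear f" "\<bar>det (matrix f)\<bar> = 1"
    and eq: "\<And>b. 0 \<le> b \<Longrightarrow> measure lebesgue (f ` cbox 0 b) = measure lebesgue (cbox 0 b)"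
  for f :: "real^'n \<Rightarrow> real^'n"
  proof -
    have "measure lebesgue (f ` cbox a b) = 1 * measure lebesgue (cbox a b)" for a b
    proof (cases "cbox a b = {}")
      case False
      then have "0 \<le> b - a"
        by (auto simp: interval_ne_empty_cart less_eq_vec_def)
      have "cbox a b = (+) a ` cbox 0 (b - a)"
        by (simp add: cbox_translation[symmetric])
      moreover from this have "f ` cbox a b = (+) (f a) ` f ` cbox 0 (b - a)"
        using f by (simp add: image_image linear_add)
      ultimately show ?thesis
        using eq[OF \<open>0 \<le> b - a\<close>] by (simp only: measure_translation mult_1)
    qed simp
    from measure_linear_sufficient[OF f(1) _ this]
    show ?thesis unfolding P_def f(2) by metis
  qed
  have "P f"
  proof (rule induct_linear_elementary[OF \<open>linear f\<close>])
    fix f g :: "real^'n \<Rightarrow> real^'n"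
    assume lin: "linear f" "linear g" and f: "P f" and g: "P g"
    show "P (f \<circ> g)"
      unfolding P_def
    proof
      fix S :: "(real^'n) set" assume S: "S \<in> lmeasurable"
      note gS = bspec[OF g[unfolded P_def] S]
      note fgS = bspec[OF f[unfolded P_def] conjunct1[OF gS]]
      show "(f \<circ> g) ` S \<in> lmeasurable \<and>
          measure lebesgue ((f \<circ> g) ` S) = \<bar>det (matrix (f \<circ> g))\<bar> * measure lebesgue S"
        unfolding image_comp[symmetric] matrix_compose[OF lin(2,1)] det_mul abs_mult
        by (simp only: fgS gS mult.assoc simp_thms)
    qed
  next
    fix f :: "real^'n \<Rightarrow> real^'n" and i
    assume f: "linear f" and "\<And>x. f x $ i = 0"
    then have "\<not> surj f"
      by (metis axis_nth surjD zero_neq_one)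
    then have "\<not> inj f" using f linear_injective_imp_surjective by blast
    moreover from this have "det (matrix f) = 0"
      using det_nz_iff_inj[OF f] by blast
    ultimately show "P f"
      using negligible_linear_singular_image[OF f] negligible_iff_measure[of "f ` _"]
      by (simp add: P_def)
  next
    fix c :: "'n \<Rightarrow> real"
    have "matrix (\<lambda>x. \<chi> i. c i * x $ i) = (\<chi> i j. if i = j then c i else 0)"
      by (auto simp: matrix_def axis_def vec_eq_iff)
    then show "P (\<lambda>x. \<chi> i. c i * x $ i)"
      by (simp add: P_def measurable_stretch measure_stretch det_diagonal)
  next
    fix m n :: 'n assume "m \<noteq> n"
    let ?t = "Transposition.transpose m n"
    let ?h = "\<lambda>x::real^'n. \<chi> i. x $ ?t i"
    have t: "?t permutes UNIV" by (simp add: permutes_swap_id)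
    show "P ?h"
    proof (rule box)
      show "linear ?h" by (rule linearI) (simp_all add: vec_eq_iff)
      have "matrix ?h = (\<chi> i. mat 1 $ ?t i)"
        by (auto simp: matrix_def mat_def axis_def vec_eq_iff)
      then show "\<bar>det (matrix ?h)\<bar> = 1"
        using det_permute_rows[OF t, of "mat 1 :: real^'n^'n"]
        by (simp add: sign_def abs_if)
      fix b :: "real^'n" assume "0 \<le> b"
      have "?h ` cbox 0 b = cbox 0 (?h b)"
      proof (intro set_eqI iffI)
        fix x assume "x \<in> cbox 0 (?h b)"
        then have "?h x \<in> cbox 0 b"
          by (auto simp: mem_box_cart) (metis transpose_involutory)
        moreover have "x = ?h (?h x)" by (simp add: vec_eq_iff)
        ultimately show "x \<in> ?h ` cbox 0 b" by blast
      qed (auto simp: mem_box_cart)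
      moreover have "cbox 0 (?h b) \<noteq> {}" "cbox 0 b \<noteq> {}"
        using \<open>0 \<le> b\<close> by (auto simp: interval_ne_empty_cart less_eq_vec_def)
      moreover have "(\<Prod>i\<in>UNIV. b $ ?t i) = (\<Prod>i\<in>UNIV. b $ i)"
        using prod.permute[OF t, of "\<lambda>i. b $ i"] by (simp add: comp_def)
      ultimately show "measure lebesgue (?h ` cbox 0 b) = measure lebesgue (cbox 0 b)"
        by (simp add: content_cbox_if_cart)
    qed
  next
    fix m n :: 'n assume mn: "m \<noteq> n"
    let ?h = "\<lambda>x::real^'n. \<chi> i. if i = m then x $ m + x $ n else x $ i"
    show "P ?h"
    proof (rule box)
      show "linear ?h" by (rule linearI) (auto simp: vec_eq_iff algebra_simps)
      show "\<bar>det (matrix ?h)\<bar> = 1" using det_shear[OF mn] by simp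
      fix b :: "real^'n" assume "0 \<le> b"
      then have "cbox 0 b \<noteq> {}"
        by (auto simp: interval_ne_empty_cart less_eq_vec_def)
      then show "measure lebesgue (?h ` cbox 0 b) = measure lebesgue (cbox 0 b)"
        using measure_shear_interval[OF mn] by simp
    qed
  qed
  with assms(2) show "f ` S \<in> lmeasurable"
    "measure lebesgue (f ` S) = \<bar>det (matrix f)\<bar> * measure lebesgue S" by (auto simp: P_def)
qed

lemma measure_affine_image_cball:
  fixes A :: "real^'n^'n"
  shows "measure lebesgue ((\<lambda>x. A *v x + a) ` cball 0 1) = \<bar>det A\<bar> * measure lebesgue (cball (0::real^'n) 1)"
proof -
  have "(\<lambda>x. A *v x + a) ` cball 0 1 = (+) a ` (*v) A ` cball 0 1"
    by (simp add: image_image add.commute)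
  then show ?thesis
    by (simp add: measure_translation measure_linear_image_cart)
qed

section \<open>Contact points and weights\<close>

text \<open>The inner product of matrices is the entrywise one, so linear functionals on matrices
  become quadratic forms on the tensors of contact points.\<close>

lemma inner_tensor: "G \<bullet> tensor u u = u \<bullet> (G *v u)" for G :: "real^'n^'n"
  by (simp add: inner_vec_def matrix_vector_mult_def tensor_def sum_distrib_left mult_ac)

lemma inner_mat_1: "G \<bullet> mat 1 = trace G" for G :: "real^'n^'n"
  by (simp add: inner_vec_def mat_def trace_def if_distrib cong: if_cong)

lemma tensor_mult_vec: "tensor u v *v x = (v \<bullet> x) *\<^sub>R u"
  by (simp add: vec_eq_iff matrix_vector_mult_def tensor_def inner_vec_def sum_distrib_left mult_ac)

text \<open>A hyperplane supporting \<open>C\<close> at \<open>u\<close> also supports the unit ball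
  there, so its normal must be a multiple of \<open>u\<close>.\<close>

lemma contact_point:
  fixes C :: "'a::euclidean_space set"
  assumes "closed C" "convex C" "cball 0 1 \<subseteq> C" and u: "u \<in> cball 0 1 \<inter> frontier C"
  shows contact_point_norm: "norm u = 1" and contact_point_halfspace: "\<And>x. x \<in> C \<Longrightarrow> u \<bullet> x \<le> 1"
proof -
  have ball: "ball 0 1 \<subseteq> interior C"
    using assms(3) by (intro interior_maximal) auto
  then have "rel_interior C = interior C"
    by (intro rel_interior_nonempty_interior) auto
  then have "u \<notin> rel_interior C" "u \<in> C"
    using u assms(1) by (auto simp: frontier_def)
  then obtain a where a: "a \<noteq> 0" "\<And>y. y \<in> C \<Longrightarrow> a \<bullet> u \<le> a \<bullet> y"
    using supporting_hyperplane_rel_boundary[OF assms(2)] by metis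
  have "u \<notin> ball 0 1" using ball u by (auto simp: frontier_def)
  then show nu: "norm u = 1" using u by auto
  \<comment> \<open>The point of the ball extreme in direction \<open>- a\<close> forces equality in
    Cauchy-Schwarz for \<open>a\<close> and \<open>u\<close>, so that
    \<open>a + norm a *\<^sub>R u\<close> has length 0.\<close>
  have "- (a /\<^sub>R norm a) \<in> C"
    using a by (intro subsetD[OF assms(3)]) simp
  then have "a \<bullet> u \<le> a \<bullet> - (a /\<^sub>R norm a)" by (rule a)
  also have "\<dots> = - norm a"
    using a by (simp add: dot_square_norm power2_eq_square)
  finally have le: "a \<bullet> u \<le> - norm a" .
  have "(a + norm a *\<^sub>R u) \<bullet> (a + norm a *\<^sub>R u) = 2 * (norm a)\<^sup>2 + 2 * norm a * (a \<bullet> u)"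
  proof -
    have "u \<bullet> u = 1" "a \<bullet> a = (norm a)\<^sup>2" using nu by (simp_all add: dot_square_norm)
    then show ?thesis
      by (simp add: inner_add_left inner_add_right inner_commute[of u a] power2_eq_square algebra_simps)
  qed
  also have "\<dots> \<le> 2 * (norm a)\<^sup>2 + 2 * norm a * (- norm a)"
    using le by (intro add_left_mono mult_left_mono) auto
  finally have "(a + norm a *\<^sub>R u) \<bullet> (a + norm a *\<^sub>R u) \<le> 0"
    by (simp add: power2_eq_square)
  then have "a + norm a *\<^sub>R u = 0"
    by (metis inner_eq_zero_iff inner_ge_zero order_antisym)
  then have a_eq: "a = - (norm a *\<^sub>R u)" by (rule eq_neg_iff_add_eq_0[THEN iffD2])
  show "u \<bullet> x \<le> 1" if "x \<in> C" for x
  proof -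
    have "- norm a = a \<bullet> u"
      by (subst (2) a_eq) (simp add: dot_square_norm nu)
    also have "\<dots> \<le> a \<bullet> x" using that by (rule a)
    also have "\<dots> = - (norm a * (u \<bullet> x))"
      by (subst a_eq) simp
    finally have "norm a * (u \<bullet> x) \<le> norm a * 1" by simp
    then show ?thesis using a by (simp add: mult_le_cancel_left)
  qed
qed

text \<open>Pairing the decomposition \<open>I\<close> with a matrix \<open>G\<close> turns
  \<open>trace G\<close> into a weighted sum of \<open>u k \<bullet> (G *v u k)\<close>. This is
  used for \<open>A\<close>, \<open>mat 1\<close> and \<open>tensor a a\<close>.\<close>

lemma contact_ellipsoid_eq_cball:
  fixes C :: "(real^'n) set" and u :: "'k \<Rightarrow> real^'n"
  assumes C: "closed C" "convex C" "cball 0 1 \<subseteq> C"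
    and K: "finite K" and u: "\<And>k. k \<in> K \<Longrightarrow> u k \<in> cball 0 1 \<inter> frontier C"
    and c: "\<And>k. k \<in> K \<Longrightarrow> c k > 0"
    and I: "mat 1 = (\<Sum>k\<in>K. c k *\<^sub>R tensor (u k) (u k))"
    and O: "0 = (\<Sum>k\<in>K. c k *\<^sub>R u k)"
    and A: "sym_pos_def A" "(\<lambda>x. A *v x + a) ` cball 0 1 \<subseteq> C" and det: "\<bar>det A\<bar> \<ge> 1"
  shows "A = mat 1 \<and> a = 0"
proof -
  have inner_I: "G \<bullet> mat 1 = (\<Sum>k\<in>K. c k * (u k \<bullet> (G *v u k)))" for G
    unfolding I by (simp add: inner_sum_right inner_tensor)
  have sum_a: "(\<Sum>k\<in>K. c k * (u k \<bullet> a)) = 0"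
    using arg_cong[OF O, of "\<lambda>v. v \<bullet> a"] by (simp add: inner_sum_left)
  have norm_u: "norm (u k) = 1" if "k \<in> K" for k
    using contact_point_norm[OF C u[OF that]] .
  have half: "u k \<bullet> (A *v u k) + u k \<bullet> a \<le> 1" if "k \<in> K" for k
  proof -
    have "A *v u k + a \<in> C" using A(2) u[OF that] by blast
    then have "u k \<bullet> (A *v u k + a) \<le> 1"
      by (rule contact_point_halfspace[OF C u[OF that]])
    then show ?thesis by (simp add: inner_add_right)
  qed
  have "trace A = (\<Sum>k\<in>K. c k * (u k \<bullet> (A *v u k) + u k \<bullet> a))"
    using inner_I[of A] sum_a by (simp add: inner_mat_1 distrib_left sum.distrib)
  also have "\<dots> \<le> (\<Sum>k\<in>K. c k * (u k \<bullet> u k))"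
    using half norm_u c by (intro sum_mono mult_left_mono) (auto simp: dot_square_norm less_imp_le)
  also have "\<dots> = CARD('n)"
    using inner_I[of "mat 1"] by (simp add: inner_mat_1 trace_I)
  finally have A1: "A = mat 1"
    using sym_pos_def_trace_det_eq_mat_1[OF A(1) _ det] by simp
  \<comment> \<open>For \<open>A = mat 1\<close> the half-space bound reduces to
    \<open>u k \<bullet> a \<le> 0\<close>; since the weighted sum is 0, every term
    vanishes.\<close>
  have "c k * (u k \<bullet> a) \<le> 0" if "k \<in> K" for k
    using half[OF that] norm_u[OF that] c[OF that]
    by (simp add: A1 dot_square_norm mult_nonneg_nonpos)
  then have "\<forall>k\<in>K. - (c k * (u k \<bullet> a)) = 0"
    using sum_a K by (subst sum_nonneg_eq_0_iff[symmetric]) (auto simp: sum_negf)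
  then have "u k \<bullet> a = 0" if "k \<in> K" for k
    using that c[OF that] by auto
  \<comment> \<open>Each term is \<open>c k\<close> times the square of
    \<open>u k \<bullet> a\<close>, while the whole sum equals \<open>a \<bullet> a\<close> by the
    decomposition.\<close>
  then have "(\<Sum>k\<in>K. c k * (u k \<bullet> (tensor a a *v u k))) = 0"
    by (simp add: tensor_mult_vec)
  then have "mat 1 \<bullet> tensor a a = 0"
    by (metis inner_I inner_commute)
  then have "a \<bullet> a = 0" by (simp add: inner_tensor)
  then show ?thesis using A1 by simp
qed

section \<open>Perturbing the unit ball\<close>

text \<open>Compactness: if no small \<open>t\<close> works, points outside \<open>C\<close> but in
  the perturbed balls accumulate at a contact point as \<open>t\<close> tends to 0, and the limiting
  sign contradicts \<open>neg\<close>. Writing the ellipsoid as a preimage avoids the inverse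
  matrix.\<close>

lemma perturbed_ball_subset:
  fixes C :: "(real^'n) set" and H :: "real^'n^'n"
  assumes C: "cball 0 1 \<subseteq> C"
    and neg: "\<And>u. u \<in> cball 0 1 \<inter> frontier C \<Longrightarrow> u \<bullet> (H *v u + h) < 0"
    and "e0 > 0"
  obtains t where "0 < t" "t < e0" "{x. norm ((mat 1 - t *\<^sub>R H) *v (x - t *\<^sub>R h)) \<le> 1} \<subseteq> C"
proof (rule ccontr)
  assume no: "\<not> thesis"
  note thesis_intro = that
  obtain K where K: "K > 0" "\<And>x. norm (H *v x) \<le> norm x * K"
    using bounded_linear.pos_bounded[where f = "(*v) H", OF matrix_vector_mul_bounded_linear] by blast
  have M: "(mat 1 - t *\<^sub>R H) *v y = y - t *\<^sub>R (H *v y)" for t y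
    by (simp add: matrix_vector_mult_diff_rdistrib scaleR_matrix_vector_assoc)
  have "\<exists>t x. 0 < t \<and> t < e \<and> norm (x - t *\<^sub>R h - t *\<^sub>R (H *v (x - t *\<^sub>R h))) \<le> 1 \<and> x \<notin> C"
    if "e > 0" for e
  proof -
    have "\<not> {x. norm ((mat 1 - (min e e0 / 2) *\<^sub>R H) *v (x - (min e e0 / 2) *\<^sub>R h)) \<le> 1} \<subseteq> C"
      using no thesis_intro[of "min e e0 / 2"] \<open>e0 > 0\<close> \<open>e > 0\<close>
      by (auto simp: min_less_iff_disj)
    then show ?thesis
      using \<open>e0 > 0\<close> \<open>e > 0\<close> unfolding M by (intro exI[of _ "min e e0 / 2"]) auto
  qed
  \<comment> \<open>The bound \<open>1 / (2 * K)\<close> lets \<open>t *\<^sub>R H\<close> at most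
    halve lengths, which keeps the points bounded; the other bound sends \<open>t\<close> to
    0.\<close>
  from this[of "min (1 / (2 * K)) (inverse (real (Suc n)))" for n]
  have "\<exists>t x. 0 < t \<and> t < min (1 / (2 * K)) (inverse (real (Suc n))) \<and>
      norm (x - t *\<^sub>R h - t *\<^sub>R (H *v (x - t *\<^sub>R h))) \<le> 1 \<and> x \<notin> C" for n
    using K(1) by (simp del: of_nat_Suc)
  then obtain t X where tX: "\<And>n. 0 < t n \<and> t n < min (1 / (2 * K)) (inverse (real (Suc n))) \<and>
      norm (X n - t n *\<^sub>R h - t n *\<^sub>R (H *v (X n - t n *\<^sub>R h))) \<le> 1 \<and> X n \<notin> C"
    by metis
  then have t: "\<And>n. 0 < t n" "\<And>n. t n < 1 / (2 * K)" "\<And>n. t n < inverse (real (Suc n))"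
    and X: "\<And>n. norm (X n - t n *\<^sub>R h - t n *\<^sub>R (H *v (X n - t n *\<^sub>R h))) \<le> 1" "\<And>n. X n \<notin> C"
    by (simp_all del: of_nat_Suc)
  have t0: "t \<longlonglongrightarrow> 0"
  proof (rule real_tendsto_sandwich[OF _ _ tendsto_const LIMSEQ_inverse_real_of_nat])
  qed (use t in \<open>auto intro!: always_eventually less_imp_le\<close>)
  have "norm (X n) \<le> 2 + norm h / (2 * K)" for n
  proof -
    define z where "z = X n - t n *\<^sub>R h"
    have "norm (t n *\<^sub>R (H *v z)) \<le> t n * (norm z * K)"
      using t(1)[of n] K(2)[of z] by (simp add: mult_left_mono)
    also have "\<dots> \<le> 1 / (2 * K) * (norm z * K)"
      using t(2)[of n] K by (intro mult_right_mono) auto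
    also have "\<dots> = norm z / 2" using K by simp
    finally have "norm z \<le> 2"
      using X(1)[of n] norm_triangle_sub[of z "t n *\<^sub>R (H *v z)"] unfolding z_def[symmetric] by linarith
    moreover have "norm (t n *\<^sub>R h) \<le> 1 / (2 * K) * norm h"
      using mult_right_mono[OF less_imp_le[OF t(2)] norm_ge_zero, of n h] t(1)[of n] by simp
    ultimately show ?thesis
      using norm_triangle_ineq[of z "t n *\<^sub>R h"] by (simp add: z_def)
  qed
  then have "\<forall>n. X n \<in> cball 0 (2 + norm h / (2 * K))" by simp
  then obtain l r where r: "strict_mono r" and l: "(X \<circ> r) \<longlonglongrightarrow> l"
    using compact_cball[of "0 :: real^'n"] unfolding compact_def by blast
  have tr: "(\<lambda>n. t (r n)) \<longlonglongrightarrow> 0"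
    using LIMSEQ_subseq_LIMSEQ[OF t0 r] by (simp add: o_def)
  have Xr: "(\<lambda>n. X (r n)) \<longlonglongrightarrow> l" using l by (simp add: o_def)
  note lim = tendsto_intros tr Xr bounded_linear.tendsto[OF matrix_vector_mul_bounded_linear]
  have "(\<lambda>n. X (r n) - t (r n) *\<^sub>R h - t (r n) *\<^sub>R (H *v (X (r n) - t (r n) *\<^sub>R h))) \<longlonglongrightarrow>
      l - 0 *\<^sub>R h - 0 *\<^sub>R (H *v (l - 0 *\<^sub>R h))"
    by (intro lim)
  then have "norm l \<le> 1"
    using X(1) by (intro Lim_norm_ubound[of sequentially]) (auto intro!: always_eventually)
  have "l \<notin> interior C"
  proof
    assume "l \<in> interior C"
    then have "eventually (\<lambda>n. X (r n) \<in> interior C) sequentially"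
      using topological_tendstoD[OF Xr open_interior] by blast
    then show False
      using X(2) interior_subset by (auto simp: eventually_sequentially)
  qed
  moreover have "l \<in> C" using C \<open>norm l \<le> 1\<close> by auto
  ultimately have "l \<in> cball 0 1 \<inter> frontier C"
    using \<open>norm l \<le> 1\<close> closure_subset by (auto simp: frontier_def)
  then have "l \<bullet> (H *v l + h) < 0" by (rule neg)
  moreover have "(\<lambda>n. X (r n) \<bullet> (H *v (X (r n) - t (r n) *\<^sub>R h) + h)) \<longlonglongrightarrow> l \<bullet> (H *v (l - 0 *\<^sub>R h) + h)"
    by (intro lim)
  \<comment> \<open>\<open>X n\<close> lies outside the unit ball while its image under the perturbation lies inside\<close>
  moreover have "0 \<le> X n \<bullet> (H *v (X n - t n *\<^sub>R h) + h)" for n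
  proof -
    define q where "q = H *v (X n - t n *\<^sub>R h) + h"
    have "norm (X n) > 1" using X(2)[of n] C by force
    moreover have "norm (X n - t n *\<^sub>R q) \<le> 1"
      using X(1)[of n] by (simp add: q_def algebra_simps)
    ultimately have "norm (X n - t n *\<^sub>R q) \<le> norm (X n)" by simp
    then have "(X n - t n *\<^sub>R q) \<bullet> (X n - t n *\<^sub>R q) \<le> X n \<bullet> X n"
      by (simp add: norm_le)
    then have "(t n *\<^sub>R q) \<bullet> (t n *\<^sub>R q) \<le> 2 * t n * (X n \<bullet> q)"
      by (simp add: inner_diff_left inner_diff_right inner_commute[of q "X n"] algebra_simps)
    then have "0 \<le> 2 * t n * (X n \<bullet> q)"
      using inner_ge_zero order_trans by blast
    then show ?thesis using t(1)[of n] by (simp add: q_def zero_le_mult_iff)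
  qed
  then have "0 \<le> X (r n) \<bullet> (H *v (X (r n) - t (r n) *\<^sub>R h) + h)" for n .
  ultimately have "0 \<le> l \<bullet> (H *v l + h)"
    by (intro LIMSEQ_le_const[of "\<lambda>n. X (r n) \<bullet> (H *v (X (r n) - t (r n) *\<^sub>R h) + h)"]) auto
  with \<open>l \<bullet> (H *v l + h) < 0\<close> show False by simp
qed

section \<open>Positive definite matrices: inverses and neighbours of the identity\<close>

lemma sym_pos_def_inverse:
  assumes "sym_pos_def M"
  obtains N where "sym_pos_def N" "M ** N = mat 1" "N ** M = mat 1"
proof -
  have tr: "transpose M = M" and pos: "\<And>x. x \<noteq> 0 \<Longrightarrow> x \<bullet> (M *v x) > 0"
    using assms by (auto simp: sym_pos_def_def)
  have "x = 0" if "M *v x = 0" for x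
    using pos[of x] that by (cases "x = 0") auto
  then obtain N where N: "N ** M = mat 1"
    using matrix_left_invertible_ker[of M] by blast
  then have MN: "M ** N = mat 1" by (simp add: matrix_left_right_inverse)
  have "transpose N ** M = mat 1"
    using arg_cong[OF MN, of transpose] by (simp add: matrix_transpose_mul tr)
  then have "transpose N = N"
    by (metis MN matrix_mul_assoc matrix_mul_lid matrix_mul_rid)
  moreover have "x \<bullet> (N *v x) > 0" if "x \<noteq> 0" for x
  proof -
    have x: "M *v (N *v x) = x" by (simp add: matrix_vector_mul_assoc MN)
    then have "N *v x \<noteq> 0" using that by force
    then show ?thesis using pos[of "N *v x"] x by (simp add: inner_commute)
  qed
  ultimately have "sym_pos_def N" by (simp add: sym_pos_def_def)
  then show thesis using MN N by (rule that)
qed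

lemma sym_pos_def_mat_1: "sym_pos_def (mat 1)"
  by (simp add: sym_pos_def_def)

lemma ellipsoid_cball: "ellipsoid (cball 0 1 :: (real^'n) set)"
  unfolding ellipsoid_def
  by (intro exI[of _ "mat 1"] exI[of _ 0]) (simp add: sym_pos_def_mat_1)

text \<open>If \<open>K\<close> bounds the operator norm of \<open>H\<close>, the quadratic form of
  \<open>mat 1 - t *\<^sub>R H\<close> is at least \<open>(1 - t * K) * (norm x)\<^sup>2\<close>, so
  \<open>1 / K\<close> serves as \<open>e\<close>.\<close>

lemma sym_pos_def_near_mat_1:
  fixes H :: "real^'n^'n"
  assumes H: "transpose H = H"
  obtains e where "e > 0" "\<And>t. 0 < t \<Longrightarrow> t < e \<Longrightarrow> sym_pos_def (mat 1 - t *\<^sub>R H)"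
proof -
  obtain K where K: "K > 0" "\<And>x. norm (H *v x) \<le> norm x * K"
    using bounded_linear.pos_bounded[where f = "(*v) H", OF matrix_vector_mul_bounded_linear] by blast
  have "sym_pos_def (mat 1 - t *\<^sub>R H)" if t: "0 < t" "t < 1 / K" for t
    unfolding sym_pos_def_def
  proof (intro conjI allI impI)
    show "transpose (mat 1 - t *\<^sub>R H) = mat 1 - t *\<^sub>R H"
      using H by (simp add: vec_eq_iff transpose_def mat_def)
    fix x :: "real^'n" assume "x \<noteq> 0"
    have "x \<bullet> (H *v x) \<le> norm x * (norm x * K)"
      using norm_cauchy_schwarz[of x "H *v x"] mult_left_mono[OF K(2)[of x] norm_ge_zero[of x]]
      by linarith
    then have "t * (x \<bullet> (H *v x)) \<le> t * (norm x * (norm x * K))"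
      using t by (intro mult_left_mono) auto
    also have "\<dots> = (t * K) * (norm x)\<^sup>2" by (simp add: power2_eq_square)
    also have "\<dots> < 1 * (norm x)\<^sup>2"
      using t K \<open>x \<noteq> 0\<close> by (intro mult_strict_right_mono) (auto simp: field_simps)
    finally show "x \<bullet> ((mat 1 - t *\<^sub>R H) *v x) > 0"
      by (simp add: matrix_vector_mult_diff_rdistrib scaleR_matrix_vector_assoc[symmetric] inner_diff_right
          dot_square_norm)
  qed
  then show thesis using that[of "1 / K"] K by simp
qed

text \<open>Otherwise an ellipsoid with matrix \<open>N\<close>, the inverse of
  \<open>M = mat 1 - t *\<^sub>R H\<close>, fits into \<open>C\<close>. Maximality gives
  \<open>\<bar>det M\<bar> \<ge> 1\<close> although \<open>trace M < CARD('n)\<close>, and the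
  equality case \<open>M = mat 1\<close> contradicts this strict bound.\<close>

lemma max_volume_cball_no_perturbation:
  fixes C :: "(real^'n) set" and H :: "real^'n^'n"
  assumes C: "cball 0 1 \<subseteq> C" and max: "max_volume_ellipsoid C (cball 0 1)"
    and H: "transpose H = H" "trace H > 0"
  obtains u where "u \<in> cball 0 1 \<inter> frontier C" "u \<bullet> (H *v u + h) \<ge> 0"
proof (rule ccontr)
  assume "\<not> thesis"
  note thesis_intro = that
  have neg: "u \<bullet> (H *v u + h) < 0" if "u \<in> cball 0 1 \<inter> frontier C" for u
    using thesis_intro[OF that] \<open>\<not> thesis\<close> by linarith
  obtain e where e: "e > 0" "\<And>t. 0 < t \<Longrightarrow> t < e \<Longrightarrow> sym_pos_def (mat 1 - t *\<^sub>R H)"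
    using sym_pos_def_near_mat_1[OF H(1)] by blast
  obtain t where t: "0 < t" "t < e"
    and sub: "{x. norm ((mat 1 - t *\<^sub>R H) *v (x - t *\<^sub>R h)) \<le> 1} \<subseteq> C"
    using perturbed_ball_subset[OF C neg e(1)] by blast
  define M where "M = mat 1 - t *\<^sub>R H"
  have M: "sym_pos_def M" unfolding M_def using e t by blast
  obtain N where N: "sym_pos_def N" "M ** N = mat 1" "N ** M = mat 1"
    using sym_pos_def_inverse[OF M] by blast
  define F where "F = (\<lambda>x. N *v x + t *\<^sub>R h) ` cball 0 1"
  have "ellipsoid F" unfolding ellipsoid_def F_def using N by blast
  moreover have "F \<subseteq> C"
    unfolding F_def using sub
    by (auto simp: M_def[symmetric] matrix_vector_mul_assoc N image_subset_iff)
  ultimately have "measure lebesgue F \<le> measure lebesgue (cball (0::real^'n) 1)"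
    using max unfolding max_volume_ellipsoid_def by blast
  then have "\<bar>det N\<bar> \<le> 1"
    using content_cball_pos[of 1 "0 :: real^'n"]
    by (simp add: F_def measure_affine_image_cball mult_le_cancel_right1)
  moreover have "\<bar>det M\<bar> * \<bar>det N\<bar> = 1"
    using N(2) by (metis abs_mult abs_one det_I det_mul)
  ultimately have "\<bar>det M\<bar> \<ge> 1"
    by (metis abs_ge_zero mult_left_le)
  have "trace M = CARD('n) - t * trace H"
    by (simp add: M_def trace_sub trace_I) (simp add: trace_def sum_distrib_left)
  then have "trace M < CARD('n)" using t H by simp
  moreover have "M = mat 1"
    using sym_pos_def_trace_det_eq_mat_1[OF M _ \<open>\<bar>det M\<bar> \<ge> 1\<close>] calculation by simp
  ultimately show False by (simp add: trace_I)
qed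

section \<open>Separation in the space of matrix-vector pairs\<close>

lemma continuous_on_tensor: "continuous_on S (\<lambda>u. (tensor u u, u))"
  unfolding tensor_def by (intro continuous_intros)

text \<open>Contact points are unit vectors, so their tensors have trace 1; dividing the identity by
  \<open>CARD('n)\<close> gives it trace 1 as well.\<close>

lemma max_volume_cball_in_convex_hull:
  fixes C :: "(real^'n) set"
  assumes C: "compact C" "convex C" "cball 0 1 \<subseteq> C" and max: "max_volume_ellipsoid C (cball 0 1)"
  shows "(mat 1 /\<^sub>R real CARD('n), 0) \<in> convex hull ((\<lambda>u. (tensor u u, u)) ` (cball 0 1 \<inter> frontier C))"
    (is "?z \<in> convex hull ?p")
proof (rule ccontr)
  assume nz: "?z \<notin> convex hull ?p"
  have "compact (cball 0 1 \<inter> frontier C)"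
    using C by (intro compact_Int_closed) auto
  then have "compact (convex hull ?p)"
    by (intro compact_convex_hull compact_continuous_image continuous_on_tensor)
  then obtain a b where ab: "a \<bullet> ?z < b" "\<And>x. x \<in> convex hull ?p \<Longrightarrow> a \<bullet> x > b"
    using separating_hyperplane_closed_point[OF convex_convex_hull compact_imp_closed nz] by blast
  obtain G g where a: "a = (G, g)" by (cases a)
  \<comment> \<open>only the symmetric part of the normal matrix matters; on contact points \<open>b = b * (u \<bullet> u)\<close>,
    so that \<open>b\<close> can be absorbed into a quadratic form\<close>
  define H where "H = b *\<^sub>R mat 1 - (1/2) *\<^sub>R (G + transpose G)"
  have "transpose H = H"
    by (simp add: H_def vec_eq_iff transpose_def mat_def)
  moreover have "trace H > 0"
  proof -
    have "trace H = b * CARD('n) - trace G"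
      by (simp add: H_def trace_def mat_def transpose_def sum_subtractf)
    moreover have "trace G / CARD('n) < b"
      using ab(1) by (simp add: a inner_mat_1 divide_inverse mult.commute)
    ultimately show ?thesis by (simp add: divide_less_eq)
  qed
  ultimately obtain u where u: "u \<in> cball 0 1 \<inter> frontier C" "u \<bullet> (H *v u + - g) \<ge> 0"
    using max_volume_cball_no_perturbation[OF C(3) max] by blast
  have nu: "u \<bullet> u = 1"
    using contact_point_norm[OF compact_imp_closed[OF C(1)] C(2,3) u(1)] by (simp add: dot_square_norm)
  have "u \<bullet> (transpose G *v u) = u \<bullet> (G *v u)"
    by (metis dot_lmul_matrix inner_commute transpose_matrix_vector)
  then have "u \<bullet> (H *v u) = b - u \<bullet> (G *v u)"
    unfolding H_def
    by (simp only: matrix_vector_mult_diff_rdistrib matrix_vector_mult_add_rdistrib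
        scaleR_matrix_vector_assoc[symmetric] inner_diff_right inner_add_right inner_scaleR_right
        matrix_vector_mul_lid nu) simp
  \<comment> \<open>By the choice of \<open>H\<close>, the number
    \<open>u \<bullet> (H *v u + - g)\<close> is \<open>b - a \<bullet> (tensor u u, u)\<close>,
    which the separation makes negative.\<close>
  moreover have "a \<bullet> (tensor u u, u) > b"
    using u(1) by (intro ab(2) hull_inc) blast
  ultimately show False
    using u(2) by (simp add: a inner_tensor inner_diff_right inner_commute)
qed

section \<open>Counting the contact points\<close>

text \<open>A spanning family is indexed by unordered pairs of indices: singletons give the diagonal
  units, two-element sets the symmetrized off-diagonal ones.\<close>

lemma dim_symmetric_matrices:
  "dim {M :: real^'n^'n. transpose M = M} \<le> CARD('n) + (CARD('n) choose 2)"
proof -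
  define P where "P = {S :: 'n set. card S = 1} \<union> {S. card S = 2}"
  define G :: "'n set \<Rightarrow> real^'n^'n" where "G S = (\<chi> i j. if {i, j} = S then 1 else 0)" for S
  have inP: "{i, j} \<in> P" for i j
    by (cases "i = j") (auto simp: P_def)
  have "card P \<le> card {S :: 'n set. card S = 1} + card {S :: 'n set. card S = 2}"
    unfolding P_def by (rule card_Un_le)
  also have "\<dots> = CARD('n) + (CARD('n) choose 2)"
    using n_subsets[of "UNIV :: 'n set" 1] n_subsets[of "UNIV :: 'n set" 2] by simp
  finally have P: "card P \<le> CARD('n) + (CARD('n) choose 2)" .
  have "{M. transpose M = M} \<subseteq> span (G ` P)"
  proof
    fix M :: "real^'n^'n" assume "M \<in> {M. transpose M = M}"
    then have sym: "M $ i $ j = M $ j $ i" for i j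
      by (metis (mono_tags) mem_Collect_eq transpose_def vec_lambda_beta)
    \<comment> \<open>Symmetry of \<open>M\<close> makes the chosen entry independent of how
      \<open>S\<close> is listed.\<close>
    define m where "m S = (SOME r. \<exists>i j. S = {i, j} \<and> r = M $ i $ j)" for S
    have m: "m {i, j} = M $ i $ j" for i j
      unfolding m_def by (rule some_equality) (auto simp: doubleton_eq_iff sym)
    have "M = (\<Sum>S\<in>P. m S *\<^sub>R G S)"
      using inP by (simp add: vec_eq_iff G_def if_distrib m cong: if_cong)
    then show "M \<in> span (G ` P)"
      by (metis (no_types, lifting) imageI span_base span_scale span_sum)
  qed
  then have "dim {M :: real^'n^'n. transpose M = M} \<le> card (G ` P)"
    by (intro dim_le_card) auto
  also have "\<dots> \<le> card P" by (rule card_image_le) simp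
  finally show ?thesis using P by linarith
qed

text \<open>The pairs lie in the hyperplane of matrix trace 1, which misses 0, so adjoining 0 raises
  the affine dimension by exactly one. The result is at most the dimension of symmetric matrices
  plus \<open>CARD('n)\<close>. The \<open>+ 1\<close> matches the count in Caratheodory's
  theorem.\<close>

lemma aff_dim_contact_tensors:
  fixes U :: "(real^'n) set"
  assumes "\<And>u. u \<in> U \<Longrightarrow> norm u = 1"
  shows "real_of_int (aff_dim ((\<lambda>u. (tensor u u, u)) ` U) + 1) \<le> 1/2 * real CARD('n) * (real CARD('n) + 3)"
    (is "real_of_int (aff_dim ?p + 1) \<le> _")
proof -
  let ?S = "{M :: real^'n^'n. transpose M = M}"
  have sub: "subspace ?S"
    by (auto simp: subspace_def transpose_def vec_eq_iff)
  have "(mat 1, 0) \<bullet> x = 1" if "x \<in> ?p" for x :: "(real^'n^'n) \<times> (real^'n)"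
    using that assms by (auto simp: inner_tensor dot_square_norm)
  then have "affine hull ?p \<subseteq> {x. (mat 1, 0) \<bullet> x = 1}"
    by (intro hull_minimal affine_hyperplane) auto
  then have "0 \<notin> affine hull ?p" by auto
  then have "aff_dim ?p + 1 = aff_dim (insert 0 ?p)"
    by (simp add: aff_dim_insert)
  also have "\<dots> = dim (insert 0 ?p)"
    by (intro aff_dim_zero hull_inc) simp
  also have "\<dots> \<le> dim (?S \<times> (UNIV :: (real^'n) set))"
    using subspace_0[OF sub]
    by (intro of_nat_mono dim_subset) (auto simp: tensor_def transpose_def vec_eq_iff zero_prod_def)
  also have "\<dots> = dim ?S + CARD('n)"
    by (simp add: dim_Times sub)
  finally have "aff_dim ?p + 1 \<le> int (dim ?S + CARD('n))" .
  then have "real_of_int (aff_dim ?p + 1) \<le> real (dim ?S) + real CARD('n)"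
    by linarith
  also have "\<dots> \<le> 2 * real CARD('n) + real (CARD('n) choose 2)"
    using dim_symmetric_matrices[where 'n = 'n] by linarith
  also have "real (CARD('n) choose 2) = real CARD('n) * (real CARD('n) - 1) / 2"
    by (simp add: binomial_gbinomial gbinomial_prod_rev numeral_2_eq_2)
  finally show ?thesis by (simp add: field_simps)
qed

text \<open>With \<open>n \<le> CARD('n)\<close>, some nonzero \<open>x\<close> is orthogonal to all
  points but the first; \<open>O\<close> makes it orthogonal to the first too, and \<open>I\<close>
  then yields \<open>x \<bullet> x = 0\<close>.\<close>

lemma card_contact_points_gt:
  fixes u :: "nat \<Rightarrow> real^'n"
  assumes c: "\<And>k. k \<in> {1..n} \<Longrightarrow> c k > 0"
    and I: "mat 1 = (\<Sum>k=1..n. c k *\<^sub>R tensor (u k) (u k))"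
    and O: "0 = (\<Sum>k=1..n. c k *\<^sub>R u k)"
  shows "CARD('n) + 1 \<le> n"
proof (rule ccontr)
  assume "\<not> ?thesis"
  then have n: "n \<le> CARD('n)" by simp
  have "dim (u ` {2..n}) \<le> card (u ` {2..n})" by (rule dim_le_card') simp
  also have "\<dots> \<le> n - 1" using card_image_le[of "{2..n}" u] by simp
  also have "\<dots> < CARD('n)" using n zero_less_card_finite[where 'a = 'n] by linarith
  also have "\<dots> = DIM(real^'n)" by simp
  finally obtain x :: "real^'n" where x: "x \<noteq> 0" "\<And>y. y \<in> span (u ` {2..n}) \<Longrightarrow> orthogonal x y"
    by (rule orthogonal_to_subspace_exists) blast
  have ortho: "u k \<bullet> x = 0" if "k \<in> {2..n}" for k
    using x(2)[OF span_base, of "u k"] that by (auto simp: orthogonal_def inner_commute)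
  have ortho1: "u k \<bullet> x = 0" if k: "k \<in> {1..n}" for k
  proof (cases "k = 1")
    case True
    with k have "{1..n} = insert 1 {2..n}" by auto
    then have "0 = c 1 * (u 1 \<bullet> x) + (\<Sum>k=2..n. c k * (u k \<bullet> x))"
      using arg_cong[OF O, of "\<lambda>v. v \<bullet> x"] by (simp add: inner_sum_left inner_add_left)
    then show ?thesis using ortho c[OF k] True by simp
  qed (use ortho k in auto)
  have "mat 1 \<bullet> tensor x x = 0"
    unfolding I using ortho1
    by (auto simp: inner_sum_left inner_tensor[of "tensor _ _"] tensor_mult_vec intro!: sum.neutral)
  then show False using x(1) by (simp add: inner_tensor)
qed

lemma contact_weights_exist:
  fixes C :: "(real^'n) set"
  assumes C: "compact C" "convex C" "cball 0 1 \<subseteq> C" and max: "max_volume_ellipsoid C (cball 0 1)"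
  obtains n u c where "real n \<le> 1/2 * real CARD('n) * (real CARD('n) + 3)"
    "\<And>k. k \<in> {1..n} \<Longrightarrow> u k \<in> cball 0 1 \<inter> frontier C \<and> c k > 0"
    "mat 1 = (\<Sum>k=1..n. c k *\<^sub>R tensor (u k) (u k))" "0 = (\<Sum>k=1..n. c k *\<^sub>R u k)"
proof -
  define U where "U = cball 0 1 \<inter> frontier C"
  define d where "d = real CARD('n)"
  have d: "d > 0" by (simp add: d_def)
  let ?p = "(\<lambda>u. (tensor u u, u)) ` U"
  have "(mat 1 /\<^sub>R d, 0) \<in> convex hull ?p"
    using max_volume_cball_in_convex_hull[OF C max] by (simp add: U_def d_def)
  then obtain S w where S: "finite S" "S \<subseteq> ?p" "card S \<le> aff_dim ?p + 1"
    and w: "\<forall>x\<in>S. 0 \<le> w x" and sum: "(\<Sum>v\<in>S. w v *\<^sub>R v) = (mat 1 /\<^sub>R d, 0)"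
    unfolding convex_hull_caratheodory_aff_dim by blast
  \<comment> \<open>Caratheodory's weights may be 0; discarding those terms gives strict positivity
    without changing the sum.\<close>
  define T where "T = {v \<in> S. w v > 0}"
  have T: "finite T" "T \<subseteq> ?p" "card T \<le> card S"
    using S by (auto simp: T_def intro: card_mono)
  have sumT: "(\<Sum>v\<in>T. w v *\<^sub>R v) = (mat 1 /\<^sub>R d, 0)"
    unfolding sum[symmetric] T_def using S w
    by (intro sum.mono_neutral_left) (auto simp: order.order_iff_strict)
  obtain h where h: "bij_betw h {1..card T} T"
    using ex_bij_betw_nat_finite_1[OF T(1)] by blast
  define u where "u k = snd (h k)" for k
  \<comment> \<open>The factor \<open>d\<close> undoes the normalization to trace 1.\<close>
  define c where "c k = d * w (h k)" for k
  have hT: "h k \<in> T" if "k \<in> {1..card T}" for k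
    using h that by (auto simp: bij_betw_def)
  have hk: "h k = (tensor (u k) (u k), u k)" "u k \<in> U" if "k \<in> {1..card T}" for k
    using hT[OF that] T(2) by (auto simp: u_def)
  have "(\<Sum>k=1..card T. c k *\<^sub>R h k) = d *\<^sub>R (\<Sum>v\<in>T. w v *\<^sub>R v)"
    using sum.reindex_bij_betw[OF h, of "\<lambda>v. (d * w v) *\<^sub>R v"] by (simp add: c_def scaleR_sum_right)
  also have "\<dots> = (mat 1, 0)" using d by (simp add: sumT)
  finally have eq: "(\<Sum>k=1..card T. c k *\<^sub>R h k) = (mat 1, 0)" .
  show thesis
  proof (rule that)
    have "\<And>x. x \<in> U \<Longrightarrow> norm x = 1"
      unfolding U_def using contact_point_norm[OF compact_imp_closed[OF C(1)] C(2,3)] .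
    then have "real_of_int (aff_dim ?p + 1) \<le> 1/2 * real CARD('n) * (real CARD('n) + 3)"
      by (rule aff_dim_contact_tensors)
    moreover have "real (card T) \<le> real_of_int (aff_dim ?p + 1)"
      using S(3) T(3) by linarith
    ultimately show "real (card T) \<le> 1/2 * real CARD('n) * (real CARD('n) + 3)" by linarith
    show "u k \<in> cball 0 1 \<inter> frontier C \<and> c k > 0" if "k \<in> {1..card T}" for k
      using hk[OF that] hT[OF that] d by (auto simp: U_def c_def T_def)
    show "mat 1 = (\<Sum>k=1..card T. c k *\<^sub>R tensor (u k) (u k))"
      using arg_cong[OF eq, of fst] hk(1) by (simp add: fst_sum)
    show "0 = (\<Sum>k=1..card T. c k *\<^sub>R u k)"
      using arg_cong[OF eq, of snd] by (simp add: snd_sum u_def)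
  qed
qed

section \<open>The equivalence of unique maximality and the contact decomposition\<close>

theorem theorem2:
  fixes C :: "(real^'n) set"
  assumes "compact C" and "convex C" and "cball 0 1 \<subseteq> C"
  shows "(max_volume_ellipsoid C (cball 0 1) \<and>
            (\<forall>E. max_volume_ellipsoid C E \<longrightarrow> E = cball 0 1)) \<longleftrightarrow>
         (\<exists>(n::nat) (u :: nat \<Rightarrow> real^'n) (c :: nat \<Rightarrow> real).
            CARD('n) + 1 \<le> n \<and> real n \<le> 1/2 * real CARD('n) * (real CARD('n) + 3) \<and>
            (\<forall>k\<in>{1..n}. u k \<in> cball 0 1 \<inter> frontier C \<and> c k > 0) \<and>
            mat 1 = (\<Sum>k=1..n. c k *\<^sub>R tensor (u k) (u k)) \<and>
            0 = (\<Sum>k=1..n. c k *\<^sub>R u k))"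
    (is "?max \<longleftrightarrow> ?weights")
proof
  assume ?max
  then obtain n u c where nuc: "real n \<le> 1/2 * real CARD('n) * (real CARD('n) + 3)"
    "\<And>k. k \<in> {1..n} \<Longrightarrow> u k \<in> cball 0 1 \<inter> frontier C \<and> c k > 0"
    "mat 1 = (\<Sum>k=1..n. c k *\<^sub>R tensor (u k) (u k))" "0 = (\<Sum>k=1..n. c k *\<^sub>R u k)"
    using contact_weights_exist[OF assms] by blast
  moreover have "CARD('n) + 1 \<le> n"
    using card_contact_points_gt[of n c u] nuc by blast
  ultimately show ?weights by blast
next
  assume ?weights
  then obtain n u c where u: "\<And>k. k \<in> {1..n} \<Longrightarrow> u k \<in> cball 0 1 \<inter> frontier C"
    and c: "\<And>k. k \<in> {1..n::nat} \<Longrightarrow> c k > 0"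
    and I: "mat 1 = (\<Sum>k=1..n. c k *\<^sub>R tensor (u k) (u k))" and O: "0 = (\<Sum>k=1..n. c k *\<^sub>R u k)"
    by blast
  let ?B = "cball 0 1 :: (real^'n) set"
  \<comment> \<open>Comparing with the volume of the ball rather than assuming maximality lets one
    claim give both maximality and uniqueness.\<close>
  have key: "F = ?B" if ell: "ellipsoid F" and sub: "F \<subseteq> C" and vol: "measure lebesgue ?B \<le> measure lebesgue F" for F
  proof -
    obtain A a where A: "sym_pos_def A" and F: "F = (\<lambda>x. A *v x + a) ` ?B"
      using ell by (auto simp: ellipsoid_def)
    have "\<bar>det A\<bar> \<ge> 1"
      using vol content_cball_pos[of 1 "0 :: real^'n"]
      by (simp add: F measure_affine_image_cball mult_le_cancel_right2)
    then have "A = mat 1 \<and> a = 0"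
      using sub unfolding F
      by (intro contact_ellipsoid_eq_cball[OF compact_imp_closed[OF assms(1)] assms(2,3) _ u c I O A]) auto
    then show ?thesis by (simp add: F)
  qed
  have "max_volume_ellipsoid C ?B"
    unfolding max_volume_ellipsoid_def
    using key ellipsoid_cball assms(3) by (metis linorder_le_cases order_refl)
  moreover have "E = ?B" if "max_volume_ellipsoid C E" for E
    using that ellipsoid_cball assms(3) unfolding max_volume_ellipsoid_def by (intro key) auto
  ultimately show ?max by blast
qed

end
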